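(* Let $K\ge 1$ be an integer, let $\gamma\in[0,1]$, let $w_i\in\mathbb{R}^d$, let $B_0,\dots,B_{K-1},B_K$ be minibatches, and for each $k\in\{0,\dots,K\}$ let $\varphi\mapsto L(\varphi,B_k)$ be a real-valued loss on $\mathbb{R}^d$ that is three times differentiable at $w_i$. For learning rates $\lambda_{\mathrm{in}},\lambda_{o}>0$ define $\varphi_0=w_i$, $$\varphi_{k+1}=\varphi_k-\lambda_{\mathrm{in}}\nabla_{\varphi_k}L(\varphi_k,B_k),\qquad k=0,\dots,K-1,$$ the privacy-preserving loss $$L_{pp}(\gamma,w_i,\varphi_K,B_K)=L(\varphi_K,B_K)-\gamma L(w_i,B_K),$$ its gradient $g_{pp}=\nabla_{w_i}L_{pp}(\gamma,w_i,\varphi_K,B_K)$, and the outer update $w_{i+1}=w_i-\lambda_o\,g_{pp}$. Let $g_k=\nabla_{\varphi_0}L(\varphi_0,B_k)$ for $k=0,\dots,K$, $\mathcal{I}_K=\sum_{k=0}^{K-1}\nabla_{\varphi_0}\langle g_K,g_k\rangle$, and $\Delta L_{i+1}=L(w_{i+1},B_K)-L(w_i,B_K)$. Then the first-order approximations of $g_{pp}$ and $\Delta L_{i+1}$ are $$g_{pp}\approx(1-\gamma)\,g_K-\lambda_{\mathrm{in}}\,\mathcal{I}_K,$$ $$\Delta L_{i+1}\approx-\lambda_o(1-\gamma)\|g_K\|^2\le 0,$$ that is, with $w_i$, $K$, $\gamma$ and the minibatches fixed, $g_{pp}=(1-\gamma)g_K-\lambda_{\mathrm{in}}\mathcal{I}_K+O(\lambda_{\mathrm{in}}^2)$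 as $\lambda_{\mathrm{in}}\to0$, and $\Delta L_{i+1}=-\lambda_o(1-\gamma)\|g_K\|^2+O(\lambda_{\mathrm{in}}\lambda_o)+O(\lambda_o^2)$ as $(\lambda_{\mathrm{in}},\lambda_o)\to(0,0)$, where the leading term $-\lambda_o(1-\gamma)\|g_K\|^2$ is nonpositive.
   Context: Setting: privacy-preserving local meta-optimization at one outer step $i$. $w_i$ is the local meta-learner's parameter vector. The neural field parameters $\varphi$ are initialized at $\varphi_0=w_i$ and updated by $K$ gradient steps (inner loop, learning rate $\lambda_{\mathrm{in}}$) on minibatches $B_0,\dots,B_{K-1}$ sampled from the support set; $B_K$ is a minibatch of the query set, $\lambda_o$ is the outer-loop learning rate, and $\gamma$ is the regularization coefficient. $L(\varphi,B)$ denotes the loss of parameter $\varphi$ on the minibatch $B$. The gradient $\nabla_{w_i}L_{pp}$ is the total gradient with respect to $w_i$, taken through the whole inner loop, with $\varphi_K$ regarded as a function of $w_i$. In $\nabla_{\varphi_0}\langle g_K,g_k\rangle$, both $g_K$ and $g_k$ are regarded as functions of $\varphi_0$, namely $\varphi_0\mapsto\nabla L(\varphi_0,B_K)$ and $\varphi_0\mapsto\nabla L(\varphi_0,B_k)$; $\langle\cdot,\cdot\rangle$ and $\|\cdot\|$ are the Euclidean inner product and norm. The symbol $\approx$ means equality up to terms of second order in the learning rates. *)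

theory Defs
  imports "HOL-Analysis.Analysis" "HOL-Library.Landau_Symbols"
begin

(* Unspecified where f has no gradient. *)
definition grad :: "('a::real_inner \<Rightarrow> real) \<Rightarrow> 'a \<Rightarrow> 'a" where
  "grad f x = (THE D. GDERIV f x :> D)"

lemma GDERIV_imp_grad:
  assumes "GDERIV f x :> D"
  shows "grad f x = D"
  unfolding grad_def
proof (rule the_equality)
  show "GDERIV f x :> D" by (fact assms)
  fix D' assume "GDERIV f x :> D'"
  with assms have "(\<lambda>h. inner h D') = (\<lambda>h. inner h D)"
    unfolding gderiv_def by (blast intro: has_derivative_unique)
  then have "inner (D' - D) D' = inner (D' - D) D" by (rule fun_cong)
  then have "inner (D' - D) (D' - D) = 0" by (simp add: inner_diff_right)
  then show "D' = D" by simp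
qed

(* The second derivative exists on a neighbourhood of x, and its derivative exists at x itself.
   No continuity of the third derivative, and no existence of it off x, is required. *)
definition thrice_differentiable_at :: "('a::real_normed_vector \<Rightarrow> real) \<Rightarrow> 'a \<Rightarrow> bool" where
  "thrice_differentiable_at f x \<longleftrightarrow>
     (\<exists>(f' :: 'a \<Rightarrow> 'a \<Rightarrow>\<^sub>L real) (f'' :: 'a \<Rightarrow> 'a \<Rightarrow>\<^sub>L 'a \<Rightarrow>\<^sub>L real).
        (\<forall>\<^sub>F y in nhds x. (f has_derivative blinfun_apply (f' y)) (at y)) \<and>
        (\<forall>\<^sub>F y in nhds x. (f' has_derivative blinfun_apply (f'' y)) (at y)) \<and>
        f'' differentiable (at x))"

(* Below, L \<phi> b is the loss of the parameter \<phi> on the minibatch b, and B k is the k-th minibatch;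
   B K is the query minibatch. *)

primrec inner_loop ::
    "('a::real_inner \<Rightarrow> 'b \<Rightarrow> real) \<Rightarrow> (nat \<Rightarrow> 'b) \<Rightarrow> real \<Rightarrow> 'a \<Rightarrow> nat \<Rightarrow> 'a" where
  "inner_loop L B lin w 0 = w"
| "inner_loop L B lin w (Suc k) =
     inner_loop L B lin w k - lin *\<^sub>R grad (\<lambda>\<phi>. L \<phi> (B k)) (inner_loop L B lin w k)"

definition L_pp :: "('a \<Rightarrow> 'b \<Rightarrow> real) \<Rightarrow> real \<Rightarrow> 'a \<Rightarrow> 'a \<Rightarrow> 'b \<Rightarrow> real" where
  "L_pp L \<gamma> w \<phi> b = L \<phi> b - \<gamma> * L w b"

(* The privacy-preserving loss as a function of the initialization alone, so that its gradient
   is the total gradient through the inner loop. *)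
definition meta_loss ::
    "('a::real_inner \<Rightarrow> 'b \<Rightarrow> real) \<Rightarrow> (nat \<Rightarrow> 'b) \<Rightarrow> nat \<Rightarrow> real \<Rightarrow> real \<Rightarrow> 'a \<Rightarrow> real" where
  "meta_loss L B K \<gamma> lin w = L_pp L \<gamma> w (inner_loop L B lin w K) (B K)"

definition g_pp ::
    "('a::real_inner \<Rightarrow> 'b \<Rightarrow> real) \<Rightarrow> (nat \<Rightarrow> 'b) \<Rightarrow> nat \<Rightarrow> real \<Rightarrow> real \<Rightarrow> 'a \<Rightarrow> 'a" where
  "g_pp L B K \<gamma> lin w = grad (meta_loss L B K \<gamma> lin) w"

definition outer_update ::
    "('a::real_inner \<Rightarrow> 'b \<Rightarrow> real) \<Rightarrow> (nat \<Rightarrow> 'b) \<Rightarrow> nat \<Rightarrow> real \<Rightarrow> real \<Rightarrow> real \<Rightarrow> 'a \<Rightarrow> 'a" where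
  "outer_update L B K \<gamma> lin lout w = w - lout *\<^sub>R g_pp L B K \<gamma> lin w"

definition delta_L ::
    "('a::real_inner \<Rightarrow> 'b \<Rightarrow> real) \<Rightarrow> (nat \<Rightarrow> 'b) \<Rightarrow> nat \<Rightarrow> real \<Rightarrow> real \<Rightarrow> real \<Rightarrow> 'a \<Rightarrow> real" where
  "delta_L L B K \<gamma> lin lout w = L (outer_update L B K \<gamma> lin lout w) (B K) - L w (B K)"

definition batch_grad ::
    "('a::real_inner \<Rightarrow> 'b \<Rightarrow> real) \<Rightarrow> (nat \<Rightarrow> 'b) \<Rightarrow> nat \<Rightarrow> 'a \<Rightarrow> 'a" where
  "batch_grad L B k w = grad (\<lambda>\<phi>. L \<phi> (B k)) w"

definition grad_alignment ::
    "('a::real_inner \<Rightarrow> 'b \<Rightarrow> real) \<Rightarrow> (nat \<Rightarrow> 'b) \<Rightarrow> nat \<Rightarrow> 'a \<Rightarrow> 'a" where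
  "grad_alignment L B K w =
     (\<Sum>k<K. grad (\<lambda>\<phi>. inner (batch_grad L B K \<phi>) (batch_grad L B k \<phi>)) w)"

end

theory Submission
  imports Defs
begin

text \<open>
  Write \<open>H\<^sub>k\<close> for the Hessian of the \<open>k\<close>-th loss. Differentiating the inner loop step by step,
  \<open>\<phi>\<^sub>K = w - \<lambda> (\<Sum>k<K. g\<^sub>k) + O(\<lambda>\<^sup>2)\<close> and its Jacobian is \<open>J = id - \<lambda> (\<Sum>k<K. H\<^sub>k) + O(\<lambda>\<^sup>2)\<close>, all
  derivatives on the right being taken at \<open>w\<close>. The chain rule gives \<open>g_pp = J\<^sup>T g\<^sub>K(\<phi>\<^sub>K) - \<gamma> g\<^sub>K\<close>, whose
  first-order term is \<open>-\<lambda> (\<Sum>k<K. H\<^sub>K g\<^sub>k + H\<^sub>k\<^sup>T g\<^sub>K)\<close>; the gradient of \<open>\<langle>g\<^sub>K, g\<^sub>k\<rangle>\<close> is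
  \<open>H\<^sub>K\<^sup>T g\<^sub>k + H\<^sub>k\<^sup>T g\<^sub>K\<close>, so the two agree because Hessians are symmetric. The third derivative at
  \<open>w\<close> enters only through \<open>H\<^sub>k y - H\<^sub>k w = O(y - w)\<close>, which makes the remainders quadratic.
\<close>

section \<open>Landau bounds for norms of sums and products\<close>

lemma norm_add_bigo:
  assumes "(\<lambda>x. norm (f x)) \<in> O[F](h)" "(\<lambda>x. norm (g x)) \<in> O[F](h)"
  shows "(\<lambda>x. norm (f x + g x)) \<in> O[F](h :: 'a \<Rightarrow> real)"
proof -
  have "(\<lambda>x. norm (f x + g x)) \<in> O[F](\<lambda>x. norm (f x) + norm (g x))"
    by (intro bigoI[of _ 1]) (auto intro: always_eventually norm_triangle_ineq)
  also have "(\<lambda>x. norm (f x) + norm (g x)) \<in> O[F](h)"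
    using assms by (rule sum_in_bigo)
  finally show ?thesis .
qed

lemma norm_diff_bigo:
  assumes "(\<lambda>x. norm (f x)) \<in> O[F](h)" "(\<lambda>x. norm (g x)) \<in> O[F](h)"
  shows "(\<lambda>x. norm (f x - g x)) \<in> O[F](h :: 'a \<Rightarrow> real)"
  using norm_add_bigo[of f F h "\<lambda>x. - g x"] assms by simp

text \<open>Working with an arbitrary bounded bilinear product covers scaling, operator composition,
  operator application and the inner product at once; all four occur below.\<close>

lemma (in bounded_bilinear) norm_prod_bigo:
  assumes "(\<lambda>x. norm (f x)) \<in> O[F](p)" "(\<lambda>x. norm (g x)) \<in> O[F](q)"
  shows "(\<lambda>x. norm (prod (f x) (g x))) \<in> O[F](\<lambda>x. p x * q x :: real)"
proof -
  obtain C where C: "\<And>a b. norm (prod a b) \<le> norm a * norm b * C"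
    using bounded by blast
  have "(\<lambda>x. norm (prod (f x) (g x))) \<in> O[F](\<lambda>x. norm (f x) * norm (g x))"
    using C by (intro bigoI[of _ C]) (auto simp: mult.commute)
  also have "(\<lambda>x. norm (f x) * norm (g x)) \<in> O[F](\<lambda>x. p x * q x)"
    using assms by (rule landau_o.big.mult)
  finally show ?thesis .
qed

lemma norm_bigo_1_if_near:
  assumes "(\<lambda>x. norm (f x - a)) \<in> O[F](h)" and "h \<in> O[F](\<lambda>_. 1)"
  shows "(\<lambda>x. norm (f x)) \<in> O[F](\<lambda>_. 1 :: real)"
  using norm_add_bigo[OF landau_o.big_trans[OF assms] bigo_const[of "norm a"]] by simp

section \<open>Taylor remainders and symmetry of the second derivative\<close>

text \<open>Taking tolerance 1 in the definition of the derivative yields the constant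
  \<open>1 + onorm f'\<close>. Applied to the second derivative, this is how third-order
  differentiability at the point enters the development.\<close>

lemma differentiable_at_bigo:
  assumes "f differentiable at x"
  shows "(\<lambda>y. norm (f y - f x)) \<in> O[nhds x](\<lambda>y. norm (y - x))"
proof -
  obtain f' where f': "bounded_linear f'"
    and "\<forall>e>0. \<exists>d>0. \<forall>y. norm (y - x) < d \<longrightarrow> norm (f y - f x - f' (y - x)) \<le> e * norm (y - x)"
    using assms unfolding differentiable_def has_derivative_at_alt by blast
  then obtain d where "d > 0"
    and d: "\<And>y. norm (y - x) < d \<Longrightarrow> norm (f y - f x - f' (y - x)) \<le> 1 * norm (y - x)"
    using zero_less_one by blast
  have "norm (f y - f x) \<le> (1 + onorm f') * norm (y - x)" if "dist y x < d" for y
    using d[of y] onorm[OF f', of "y - x"] norm_triangle_ineq[of "f y - f x - f' (y - x)" "f' (y - x)"] that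
    by (simp add: dist_norm algebra_simps)
  then show ?thesis
    using \<open>d > 0\<close> by (intro bigoI[of _ "1 + onorm f'"]) (auto simp: eventually_nhds_metric)
qed

text \<open>The mean value inequality is applied to the linearization error on the segment from
  \<open>x\<close> to \<open>y\<close>. Every point of that segment is at most as far from
  \<open>x\<close> as \<open>y\<close> is, so comparing \<open>f'\<close> with its value at the
  centre \<open>x\<close> alone bounds the derivative of the error by
  \<open>C * norm (y - x)\<close>.\<close>

lemma quadratic_remainder_bigo:
  assumes der: "\<forall>\<^sub>F y in nhds x. (f has_derivative blinfun_apply (f' y)) (at y)"
    and lip: "(\<lambda>y. norm (f' y - f' x)) \<in> O[nhds x](\<lambda>y. norm (y - x))"
  shows "(\<lambda>y. norm (f y - f x - f' x (y - x))) \<in> O[nhds x](\<lambda>y. (norm (y - x))\<^sup>2)"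
proof -
  obtain C where C: "C > 0" "\<forall>\<^sub>F y in nhds x. norm (f' y - f' x) \<le> C * norm (y - x)"
    using lip by (auto elim!: landau_o.bigE)
  from der C(2) have "\<forall>\<^sub>F y in nhds x. (f has_derivative blinfun_apply (f' y)) (at y)
      \<and> norm (f' y - f' x) \<le> C * norm (y - x)"
    by (rule eventually_conj)
  then obtain d where d: "d > 0"
      "\<And>y. dist y x < d \<Longrightarrow> (f has_derivative blinfun_apply (f' y)) (at y)"
      "\<And>y. dist y x < d \<Longrightarrow> norm (f' y - f' x) \<le> C * norm (y - x)"
    by (auto simp: eventually_nhds_metric)
  have "norm (f y - f x - f' x (y - x)) \<le> C * (norm (y - x))\<^sup>2" if y: "dist y x < d" for y
  proof -
    have seg: "norm (z - x) \<le> norm (y - x)" if "z \<in> closed_segment x y" for z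
      using that by (auto simp: norm_minus_commute dest: segment_bound1)
    then have near: "dist z x < d" if "z \<in> closed_segment x y" for z
      using that y by (fastforce simp: dist_norm)
    have "norm (f y - f x - f' x (y - x)) \<le> norm (y - x) * (C * norm (y - x))"
    proof (rule differentiable_bound_linearization[where S = "closed_segment x y" and f' = "\<lambda>z. blinfun_apply (f' z)"])
      fix t :: real assume "t \<in> {0..1}"
      then show "x + t *\<^sub>R (y - x) \<in> closed_segment x y"
        by (auto simp: closed_segment_def algebra_simps intro!: exI[of _ t])
    next
      fix z assume z: "z \<in> closed_segment x y"
      show "(f has_derivative blinfun_apply (f' z)) (at z within closed_segment x y)"
        using d(2)[OF near[OF z]] by (rule has_derivative_at_withinI)
      have "onorm (blinfun_apply (f' z) - blinfun_apply (f' x)) = norm (f' z - f' x)"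
        by (simp add: norm_blinfun.rep_eq fun_diff_def minus_blinfun.rep_eq)
      also have "\<dots> \<le> C * norm (z - x)" using d(3)[OF near[OF z]] .
      also have "\<dots> \<le> C * norm (y - x)" using seg[OF z] C(1) by simp
      finally show "onorm (blinfun_apply (f' z) - blinfun_apply (f' x)) \<le> C * norm (y - x)" .
    qed simp
    then show ?thesis by (simp add: power2_eq_square mult_ac)
  qed
  then show ?thesis
    using d(1) by (intro bigoI[of _ C]) (auto simp: eventually_nhds_metric)
qed

text \<open>The mean value theorem is applied in the direction of \<open>u\<close> to the increment of \<open>f\<close> along \<open>t v\<close>; the
  second difference itself is symmetric in \<open>u\<close> and \<open>v\<close>, which yields the symmetry of \<open>f''\<close> below.\<close>
lemma second_difference_bound:
  fixes f :: "'a::real_normed_vector \<Rightarrow> real" and f'' :: "'a \<Rightarrow>\<^sub>L 'a \<Rightarrow>\<^sub>L real"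
  assumes der: "\<forall>\<^sub>F y in nhds x. (f has_derivative blinfun_apply (f' y)) (at y)"
    and rem: "(\<lambda>y. norm (f' y - f' x - f'' (y - x))) \<in> O[nhds x](\<lambda>y. (norm (y - x))\<^sup>2)"
  obtains D where "\<forall>\<^sub>F t in at_right 0.
    \<bar>f (x + t *\<^sub>R u + t *\<^sub>R v) - f (x + t *\<^sub>R u) - f (x + t *\<^sub>R v) + f x - t\<^sup>2 * f'' v u\<bar> \<le> D * t ^ 3"
proof -
  obtain C where C: "C > 0"
    "\<forall>\<^sub>F y in nhds x. norm (f' y - f' x - f'' (y - x)) \<le> C * (norm (y - x))\<^sup>2"
    using rem by (auto elim!: landau_o.bigE)
  from der C(2) have "\<forall>\<^sub>F y in nhds x. (f has_derivative blinfun_apply (f' y)) (at y)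
      \<and> norm (f' y - f' x - f'' (y - x)) \<le> C * (norm (y - x))\<^sup>2"
    by (rule eventually_conj)
  then obtain d where d: "d > 0"
      "\<And>y. dist y x < d \<Longrightarrow> (f has_derivative blinfun_apply (f' y)) (at y)"
      "\<And>y. dist y x < d \<Longrightarrow> norm (f' y - f' x - f'' (y - x)) \<le> C * (norm (y - x))\<^sup>2"
    by (auto simp: eventually_nhds_metric)
  \<comment> \<open>For \<open>t < d / N\<close> all points \<open>x + s u + s' v\<close> with
    \<open>s\<close> and \<open>s'\<close> in the interval from 0 to \<open>t\<close> lie in the
    ball of radius \<open>d\<close>. The summand 1 keeps \<open>N\<close> positive when
    \<open>u\<close> and \<open>v\<close> both vanish.\<close>
  define N where "N = norm u + norm v + 1"
  have "N > 0" unfolding N_def by (smt (verit) norm_ge_zero)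
  have bnd: "\<bar>f (x + t *\<^sub>R u + t *\<^sub>R v) - f (x + t *\<^sub>R u) - f (x + t *\<^sub>R v) + f x - t\<^sup>2 * f'' v u\<bar>
      \<le> (2 * C * N\<^sup>2 * norm u) * t ^ 3" if t: "0 < t" "t < d / N" for t
  proof -
    define r where "r y = f' y - f' x - f'' (y - x)" for y
    have small: "norm (s *\<^sub>R u + s' *\<^sub>R v) \<le> t * N" "t * N < d"
      if s: "0 \<le> s" "s \<le> t" "0 \<le> s'" "s' \<le> t" for s s'
    proof -
      have "norm (s *\<^sub>R u + s' *\<^sub>R v) \<le> s * norm u + s' * norm v"
        using s norm_triangle_ineq[of "s *\<^sub>R u" "s' *\<^sub>R v"] by simp
      also have "\<dots> \<le> t * norm u + t * norm v"
        using s by (intro add_mono mult_right_mono) auto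
      also have "\<dots> \<le> t * N" using t by (simp add: N_def algebra_simps)
      finally show "norm (s *\<^sub>R u + s' *\<^sub>R v) \<le> t * N" .
      show "t * N < d" using t \<open>N > 0\<close> by (simp add: field_simps)
    qed
    have near: "dist (x + s *\<^sub>R u + s' *\<^sub>R v) x < d" if s: "0 \<le> s" "s \<le> t" "0 \<le> s'" "s' \<le> t" for s s'
      using small[OF s] by (simp add: dist_norm add.assoc)
    have rbound: "norm (r (x + s *\<^sub>R u + s' *\<^sub>R v)) \<le> C * (t * N)\<^sup>2"
      if s: "0 \<le> s" "s \<le> t" "0 \<le> s'" "s' \<le> t" for s s'
    proof -
      have "norm (r (x + s *\<^sub>R u + s' *\<^sub>R v)) \<le> C * (norm (s *\<^sub>R u + s' *\<^sub>R v))\<^sup>2"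
        using d(3)[OF near[OF s]] by (simp add: r_def add.assoc)
      also have "\<dots> \<le> C * (t * N)\<^sup>2"
        using small[OF s] C(1) by (intro mult_left_mono power_mono) auto
      finally show ?thesis .
    qed
    define p where "p s = f (x + s *\<^sub>R u + t *\<^sub>R v) - f (x + s *\<^sub>R u)" for s
    define q where "q s = f' (x + s *\<^sub>R u + t *\<^sub>R v) u - f' (x + s *\<^sub>R u) u" for s
    have "DERIV p s :> q s" if s: "0 \<le> s" "s \<le> t" for s
    proof -
      have c: "DERIV (\<lambda>s. f (x + s *\<^sub>R u + s' *\<^sub>R v)) s :> f' (x + s *\<^sub>R u + s' *\<^sub>R v) u"
        if s': "0 \<le> s'" "s' \<le> t" for s'
      proof -
        have i: "((\<lambda>s. x + s *\<^sub>R u + s' *\<^sub>R v) has_derivative (\<lambda>h. h *\<^sub>R u)) (at s)"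
          by (auto intro!: derivative_eq_intros)
        have "((\<lambda>s. f (x + s *\<^sub>R u + s' *\<^sub>R v)) has_derivative
            (\<lambda>h. f' (x + s *\<^sub>R u + s' *\<^sub>R v) (h *\<^sub>R u))) (at s)"
          using has_derivative_compose[OF i d(2)[OF near[OF s s']]] .
        then show ?thesis
          by (simp add: has_field_derivative_def blinfun.scaleR_right mult_commute_abs)
      qed
      show ?thesis
        unfolding p_def[abs_def] q_def using t c[of t] c[of 0] by (intro DERIV_diff) auto
    qed
    then obtain z where z: "0 < z" "z < t" "p t - p 0 = (t - 0) * q z"
      using MVT2[OF t(1), of p q] by blast
    \<comment> \<open>The two arguments of \<open>f'\<close> differ by \<open>t v\<close>, so their
      linear parts contribute exactly \<open>t * f'' v u\<close> and only two remainders are left.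
      Writing \<open>0 *\<^sub>R v\<close> puts the second point in the form to which
      \<open>rbound\<close> applies.\<close>
    have "q z - t * f'' v u = (r (x + z *\<^sub>R u + t *\<^sub>R v) - r (x + z *\<^sub>R u + 0 *\<^sub>R v)) u"
      by (simp add: q_def r_def blinfun.bilinear_simps add.assoc)
    then have "\<bar>q z - t * f'' v u\<bar> \<le>
        norm (r (x + z *\<^sub>R u + t *\<^sub>R v) - r (x + z *\<^sub>R u + 0 *\<^sub>R v)) * norm u"
      using norm_blinfun by (metis real_norm_def)
    also have "\<dots> \<le> (C * (t * N)\<^sup>2 + C * (t * N)\<^sup>2) * norm u"
      using z t by (intro mult_right_mono order_trans[OF norm_triangle_ineq4] add_mono rbound) auto
    finally have *: "\<bar>q z - t * f'' v u\<bar> \<le> 2 * C * N\<^sup>2 * norm u * t\<^sup>2"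
      by (simp add: power_mult_distrib mult_ac)
    have "f (x + t *\<^sub>R u + t *\<^sub>R v) - f (x + t *\<^sub>R u) - f (x + t *\<^sub>R v) + f x - t\<^sup>2 * f'' v u
        = t * (q z - t * f'' v u)"
      using z(3) by (simp add: p_def algebra_simps power2_eq_square)
    also have "\<bar>\<dots>\<bar> \<le> t * (2 * C * N\<^sup>2 * norm u * t\<^sup>2)"
      using mult_left_mono[OF *, of t] t by (simp add: abs_mult)
    finally show ?thesis by (simp add: power3_eq_cube power2_eq_square mult_ac)
  qed
  moreover have "d / N > 0" using d(1) \<open>N > 0\<close> by simp
  ultimately show ?thesis
    by (intro that[of "2 * C * N\<^sup>2 * norm u"]) (auto simp: eventually_at_right_field)
qed

text \<open>Exchanging \<open>u\<close> and \<open>v\<close> leaves the second difference unchanged.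
  Comparing its two estimates gives a discrepancy of order \<open>t ^ 3\<close> between quantities
  of size \<open>t\<^sup>2\<close>; dividing by \<open>t\<^sup>2\<close> and letting
  \<open>t\<close> tend to 0 forces equality.\<close>

lemma second_derivative_symmetric:
  fixes f :: "'a::real_normed_vector \<Rightarrow> real" and f'' :: "'a \<Rightarrow>\<^sub>L 'a \<Rightarrow>\<^sub>L real"
  assumes "\<forall>\<^sub>F y in nhds x. (f has_derivative blinfun_apply (f' y)) (at y)"
    and "(\<lambda>y. norm (f' y - f' x - f'' (y - x))) \<in> O[nhds x](\<lambda>y. (norm (y - x))\<^sup>2)"
  shows "f'' u v = f'' v u"
proof -
  obtain D where
    "\<forall>\<^sub>F t in at_right 0.
      \<bar>f (x + t *\<^sub>R u + t *\<^sub>R v) - f (x + t *\<^sub>R u) - f (x + t *\<^sub>R v) + f x - t\<^sup>2 * f'' v u\<bar> \<le> D * t ^ 3"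
    by (rule second_difference_bound[OF assms])
  moreover obtain E where
    "\<forall>\<^sub>F t in at_right 0.
      \<bar>f (x + t *\<^sub>R v + t *\<^sub>R u) - f (x + t *\<^sub>R v) - f (x + t *\<^sub>R u) + f x - t\<^sup>2 * f'' u v\<bar> \<le> E * t ^ 3"
    by (rule second_difference_bound[OF assms])
  moreover have "\<forall>\<^sub>F t in at_right (0::real). t > 0" by (simp add: eventually_at_right_less)
  ultimately have *: "\<forall>\<^sub>F t in at_right 0. \<bar>f'' u v - f'' v u\<bar> \<le> (D + E) * t"
  proof eventually_elim
    case (elim t)
    have "\<bar>t\<^sup>2 * f'' u v - t\<^sup>2 * f'' v u\<bar> \<le> D * t ^ 3 + E * t ^ 3"
      using elim by (simp add: add.assoc add.commute[of "t *\<^sub>R v"])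
    also have "\<bar>t\<^sup>2 * f'' u v - t\<^sup>2 * f'' v u\<bar> = t\<^sup>2 * \<bar>f'' u v - f'' v u\<bar>"
      by (simp add: right_diff_distrib[symmetric] abs_mult)
    also have "D * t ^ 3 + E * t ^ 3 = t\<^sup>2 * ((D + E) * t)"
      by (simp add: algebra_simps power2_eq_square power3_eq_cube)
    finally show ?case using elim by simp
  qed
  have "((\<lambda>t. (D + E) * t) \<longlongrightarrow> (D + E) * 0) (at_right 0)"
    by (intro tendsto_intros)
  then have "\<bar>f'' u v - f'' v u\<bar> \<le> (D + E) * 0"
    using * by (rule tendsto_lowerbound) simp
  then show ?thesis by simp
qed

section \<open>Gradients and Hessians as vectors and operators\<close>

text \<open>In finite dimension every derivative is represented by the vector of its values on the
  basis. Hence the description operator in \<open>grad\<close> denotes a true gradient wherever a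
  derivative exists.\<close>

lemma has_derivative_imp_GDERIV_grad:
  fixes f :: "'a::euclidean_space \<Rightarrow> real"
  assumes "(f has_derivative f') (at x)"
  shows "GDERIV f x :> grad f x" and "inner h (grad f x) = f' h"
proof -
  define D where "D = (\<Sum>b\<in>Basis. f' b *\<^sub>R b)"
  interpret f': bounded_linear f' using assms by (rule has_derivative_bounded_linear)
  have D: "inner h D = f' h" for h
  proof -
    have "f' h = f' (\<Sum>b\<in>Basis. inner h b *\<^sub>R b)" by (simp add: euclidean_representation)
    also have "\<dots> = (\<Sum>b\<in>Basis. inner h b * f' b)" by (simp add: f'.sum f'.scaleR)
    finally show ?thesis by (simp add: D_def inner_sum_right mult.commute)
  qed
  then have "f' = (\<lambda>h. inner h D)" by auto
  then have *: "GDERIV f x :> D" using assms by (simp add: gderiv_def)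
  then have "grad f x = D" by (rule GDERIV_imp_grad)
  then show "GDERIV f x :> grad f x" and "inner h (grad f x) = f' h" using * D by auto
qed

text \<open>The hypothesis speaks of functionals, the inner loop of gradient vectors. The Riesz map
  is bounded and linear, so composing with it carries derivatives over, and \<open>H\<close> is its
  composition with \<open>f''\<close>. The bound on \<open>H y - H x\<close> comes from
  differentiability of \<open>f''\<close> at \<open>x\<close>, the self-adjointness of
  \<open>H x\<close> from symmetry of \<open>f'' x\<close>.\<close>

lemma thrice_differentiable_at_hessian:
  fixes f :: "'a::euclidean_space \<Rightarrow> real"
  assumes "thrice_differentiable_at f x"
  obtains H :: "'a \<Rightarrow> 'a \<Rightarrow>\<^sub>L 'a" where
    "\<forall>\<^sub>F y in nhds x. GDERIV f y :> grad f y"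
    "\<forall>\<^sub>F y in nhds x. (grad f has_derivative blinfun_apply (H y)) (at y)"
    "(\<lambda>y. norm (H y - H x)) \<in> O[nhds x](\<lambda>y. norm (y - x))"
    "\<forall>u v. inner (H x u) v = inner u (H x v)"
proof -
  obtain f' :: "'a \<Rightarrow> 'a \<Rightarrow>\<^sub>L real" and f'' :: "'a \<Rightarrow> 'a \<Rightarrow>\<^sub>L 'a \<Rightarrow>\<^sub>L real"
    where f': "\<forall>\<^sub>F y in nhds x. (f has_derivative blinfun_apply (f' y)) (at y)"
      and f'': "\<forall>\<^sub>F y in nhds x. (f' has_derivative blinfun_apply (f'' y)) (at y)"
      and diff: "f'' differentiable (at x)"
    using assms unfolding thrice_differentiable_at_def by blast
  \<comment> \<open>the Riesz representative of a functional\<close>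
  define \<rho> :: "('a \<Rightarrow>\<^sub>L real) \<Rightarrow> 'a" where "\<rho> l = (\<Sum>b\<in>Basis. l b *\<^sub>R b)" for l
  have \<rho>: "bounded_linear \<rho>"
    unfolding \<rho>_def by (intro bounded_linear_intros)
  have inner_\<rho>: "inner h (\<rho> l) = l h" for h l
  proof -
    have "l h = l (\<Sum>b\<in>Basis. inner h b *\<^sub>R b)" by (simp add: euclidean_representation)
    also have "\<dots> = (\<Sum>b\<in>Basis. inner h b * l b)"
      by (simp add: blinfun.sum_right blinfun.scaleR_right)
    finally show ?thesis by (simp add: \<rho>_def inner_sum_right mult.commute)
  qed
  have grad_eq: "\<forall>\<^sub>F y in nhds x. GDERIV f y :> \<rho> (f' y)"
    using f' by eventually_elim (simp add: gderiv_def inner_\<rho>)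
  define H where "H y = Blinfun \<rho> o\<^sub>L f'' y" for y
  have H: "H y h = \<rho> (f'' y h)" for y h
    by (simp add: H_def bounded_linear_Blinfun_apply[OF \<rho>])
  show ?thesis
  proof (rule that[of H])
    show "\<forall>\<^sub>F y in nhds x. GDERIV f y :> grad f y"
      using grad_eq by eventually_elim (simp add: GDERIV_imp_grad)
    \<comment> \<open>Transferring a derivative at \<open>y\<close> requires the two functions to
      agree on a neighbourhood of \<open>y\<close>, so the eventual equality near \<open>x\<close>
      is first iterated.\<close>
    have "\<forall>\<^sub>F y in nhds x. \<forall>\<^sub>F z in nhds y. \<rho> (f' z) = grad f z"
      using grad_eq unfolding eventually_eventually
      by eventually_elim (simp add: GDERIV_imp_grad)
    then show "\<forall>\<^sub>F y in nhds x. (grad f has_derivative blinfun_apply (H y)) (at y)"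
      using f''
    proof eventually_elim
      case (elim y)
      have "((\<lambda>y. \<rho> (f' y)) has_derivative blinfun_apply (H y)) (at y)"
        using bounded_linear.has_derivative[OF \<rho> elim(2)] by (simp add: H[symmetric])
      moreover have "\<forall>\<^sub>F z in at y. \<rho> (f' z) = grad f z" "\<rho> (f' y) = grad f y"
        using elim(1) by (simp_all add: eventually_nhds_conv_at)
      ultimately show ?case
        by (rule has_derivative_transform_eventually) simp
    qed
    show "(\<lambda>y. norm (H y - H x)) \<in> O[nhds x](\<lambda>y. norm (y - x))"
    proof (rule differentiable_at_bigo)
      have "bounded_linear (\<lambda>A. Blinfun \<rho> o\<^sub>L A)" by (intro bounded_linear_intros)
      then show "H differentiable at x"
        using diff unfolding H_def differentiable_def by (blast dest: bounded_linear.has_derivative)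
    qed
    have "f'' x u v = f'' x v u" for u v
      using f' quadratic_remainder_bigo[OF f'' differentiable_at_bigo[OF diff]]
      by (rule second_derivative_symmetric)
    then show "\<forall>u v. inner (H x u) v = inner u (H x v)"
      by (simp add: H inner_\<rho> inner_commute[of "\<rho> _"])
  qed
qed

section \<open>Asymptotics as the learning rate tends to zero from the right\<close>

lemma power2_bigo_at_right_0: "(\<lambda>t::real. t\<^sup>2) \<in> O[at_right 0](\<lambda>t. t)"
proof (rule bigoI[of _ 1])
  have "\<forall>\<^sub>F t in at_right (0::real). 0 < t \<and> t < 1"
    by (auto simp: eventually_at_right_field intro: exI[of _ 1])
  then show "\<forall>\<^sub>F t in at_right (0::real). norm (t\<^sup>2) \<le> 1 * norm t"
    by eventually_elim (simp add: power2_eq_square)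
qed

lemma ident_bigo_1_at_right_0: "(\<lambda>t::real. t) \<in> O[at_right 0](\<lambda>_. 1)"
proof (rule bigoI[of _ 1])
  have "\<forall>\<^sub>F t in at_right (0::real). 0 < t \<and> t < 1"
    by (auto simp: eventually_at_right_field intro: exI[of _ 1])
  then show "\<forall>\<^sub>F t in at_right (0::real). norm t \<le> 1 * norm (1::real)"
    by eventually_elim simp
qed

lemma first_order_imp_near:
  assumes "(\<lambda>t. norm (f t - (a - t *\<^sub>R s))) \<in> O[at_right 0](\<lambda>t. t\<^sup>2)"
  shows "(\<lambda>t. norm (f t - a)) \<in> O[at_right 0](\<lambda>t. t)"
proof -
  have "(\<lambda>t. norm (t *\<^sub>R s)) \<in> O[at_right 0](\<lambda>t. t)"
    by (intro bigoI[of _ "norm s"]) (simp add: mult.commute)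
  from norm_diff_bigo[OF landau_o.big_trans[OF assms power2_bigo_at_right_0] this]
  show ?thesis by simp
qed

lemma near_imp_tendsto:
  assumes "(\<lambda>t. norm (f t - a)) \<in> O[at_right 0](\<lambda>t. t)"
  shows "(f \<longlongrightarrow> a) (at_right 0)"
proof -
  obtain C where C: "\<forall>\<^sub>F t in at_right 0. norm (f t - a) \<le> C * norm t"
    using assms by (auto elim!: landau_o.bigE)
  have "((\<lambda>t::real. C * norm t) \<longlongrightarrow> 0) (at_right 0)"
    by (rule tendsto_mult_right_zero[OF tendsto_norm_zero[OF tendsto_ident_at]])
  then have "((\<lambda>t. f t - a) \<longlongrightarrow> 0) (at_right 0)"
    using C by (auto intro: Lim_null_comparison)
  then show ?thesis by (rule LIM_zero_cancel)
qed

section \<open>Expansion of the inner loop and of the meta-gradient\<close>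

text \<open>Position and Jacobian go through one induction because the next Jacobian involves the
  Hessian at the current position. Each step multiplies the new gradient and Hessian terms by
  \<open>t\<close>, so knowing these terms up to \<open>O(t)\<close> already gives errors of order
  \<open>t\<^sup>2\<close>.\<close>

lemma inner_loop_expansion:
  fixes L :: "'a::euclidean_space \<Rightarrow> 'b \<Rightarrow> real" and H :: "nat \<Rightarrow> 'a \<Rightarrow> 'a \<Rightarrow>\<^sub>L 'a"
  assumes "\<And>k. k < K \<Longrightarrow> \<forall>\<^sub>F y in nhds w. (batch_grad L B k has_derivative blinfun_apply (H k y)) (at y)"
    and "\<And>k. k < K \<Longrightarrow> (\<lambda>y. norm (H k y - H k w)) \<in> O[nhds w](\<lambda>y. norm (y - w))"
  shows "\<exists>J. (\<forall>\<^sub>F t in at_right 0.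
            ((\<lambda>w. inner_loop L B t w K) has_derivative blinfun_apply (J t)) (at w)) \<and>
          (\<lambda>t. norm (inner_loop L B t w K - (w - t *\<^sub>R (\<Sum>k<K. batch_grad L B k w))))
            \<in> O[at_right 0](\<lambda>t. t\<^sup>2) \<and>
          (\<lambda>t. norm (J t - (id_blinfun - t *\<^sub>R (\<Sum>k<K. H k w)))) \<in> O[at_right 0](\<lambda>t. t\<^sup>2)"
  using assms
proof (induction K)
  case 0
  show ?case by (intro exI[of _ "\<lambda>_. id_blinfun"]) (simp add: id_blinfun.rep_eq)
next
  case (Suc K)
  define \<phi> where "\<phi> t = inner_loop L B t w K" for t
  define g where "g = batch_grad L B K"
  obtain J where
    der: "\<forall>\<^sub>F t in at_right 0. ((\<lambda>w. inner_loop L B t w K) has_derivative blinfun_apply (J t)) (at w)"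
    and \<phi>: "(\<lambda>t. norm (\<phi> t - (w - t *\<^sub>R (\<Sum>k<K. batch_grad L B k w)))) \<in> O[at_right 0](\<lambda>t. t\<^sup>2)"
    and J: "(\<lambda>t. norm (J t - (id_blinfun - t *\<^sub>R (\<Sum>k<K. H k w)))) \<in> O[at_right 0](\<lambda>t. t\<^sup>2)"
    using Suc.IH[OF Suc.prems(1)[OF less_SucI] Suc.prems(2)[OF less_SucI]]
    unfolding \<phi>_def by blast
  have g: "\<forall>\<^sub>F y in nhds w. (g has_derivative blinfun_apply (H K y)) (at y)"
    and H: "(\<lambda>y. norm (H K y - H K w)) \<in> O[nhds w](\<lambda>y. norm (y - w))"
    using Suc.prems[of K] by (simp_all add: g_def)
  note \<phi>_near = first_order_imp_near[OF \<phi>]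
  note \<phi>_lim = near_imp_tendsto[OF \<phi>_near]
  have t: "(\<lambda>t. norm t) \<in> O[at_right 0](\<lambda>t::real. t)" by simp
  have g_near: "(\<lambda>t. norm (g (\<phi> t) - g w)) \<in> O[at_right 0](\<lambda>t. t)"
  proof -
    have "g differentiable at w"
      using eventually_nhds_x_imp_x[OF g] by (auto simp: differentiable_def)
    from landau_o.big.compose[OF differentiable_at_bigo[OF this] \<phi>_lim] \<phi>_near show ?thesis
      by (rule landau_o.big_trans)
  qed
  have H_near: "(\<lambda>t. norm (H K (\<phi> t) - H K w)) \<in> O[at_right 0](\<lambda>t. t)"
    using landau_o.big.compose[OF H \<phi>_lim] \<phi>_near by (rule landau_o.big_trans)
  note J_near = first_order_imp_near[OF J]
  \<comment> \<open>The difference splits as \<open>(H K (\<phi> t) - H K w) o\<^sub>L J t\<close>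
    plus \<open>H K w o\<^sub>L (J t - id_blinfun)\<close>: in each product one factor is bounded
    and the other is \<open>O(t)\<close>.\<close>
  have HJ_near: "(\<lambda>t. norm ((H K (\<phi> t) o\<^sub>L J t) - H K w)) \<in> O[at_right 0](\<lambda>t. t)"
  proof -
    have "(\<lambda>t. norm ((H K (\<phi> t) - H K w) o\<^sub>L J t)) \<in> O[at_right 0](\<lambda>t. t * 1)"
      by (intro bounded_bilinear.norm_prod_bigo[OF bounded_bilinear_blinfun_compose] H_near
          norm_bigo_1_if_near[OF J_near] ident_bigo_1_at_right_0)
    moreover have "(\<lambda>t. norm (H K w o\<^sub>L (J t - id_blinfun))) \<in> O[at_right 0](\<lambda>t. 1 * t)"
      by (intro bounded_bilinear.norm_prod_bigo[OF bounded_bilinear_blinfun_compose] J_near) simp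
    ultimately have "(\<lambda>t. norm (((H K (\<phi> t) - H K w) o\<^sub>L J t) + (H K w o\<^sub>L (J t - id_blinfun))))
        \<in> O[at_right 0](\<lambda>t. t)"
      by (intro norm_add_bigo) simp_all
    moreover have "((H K (\<phi> t) - H K w) o\<^sub>L J t) + (H K w o\<^sub>L (J t - id_blinfun))
        = (H K (\<phi> t) o\<^sub>L J t) - H K w" for t
      by (rule blinfun_eqI) (simp add: blinfun.bilinear_simps)
    ultimately show ?thesis by simp
  qed
  \<comment> \<open>The witness is the chain rule for one gradient step, that is
    \<open>id - t H\<close> at the current position, composed with the previous Jacobian.\<close>
  show ?case
  proof (intro exI[of _ "\<lambda>t. J t - t *\<^sub>R (H K (\<phi> t) o\<^sub>L J t)"] conjI)
    have "\<forall>\<^sub>F t in at_right 0. (g has_derivative blinfun_apply (H K (\<phi> t))) (at (\<phi> t))"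
      using \<phi>_lim g by (rule filterlim_iff[THEN iffD1, rule_format])
    with der show "\<forall>\<^sub>F t in at_right 0. ((\<lambda>w. inner_loop L B t w (Suc K)) has_derivative
        blinfun_apply (J t - t *\<^sub>R (H K (\<phi> t) o\<^sub>L J t))) (at w)"
    proof eventually_elim
      case (elim t)
      have "((\<lambda>w. g (inner_loop L B t w K)) has_derivative (\<lambda>h. H K (\<phi> t) (J t h))) (at w)"
        using elim unfolding \<phi>_def by (intro has_derivative_compose[OF elim(1)]) simp
      then have "((\<lambda>w. inner_loop L B t w K - t *\<^sub>R g (inner_loop L B t w K)) has_derivative
          (\<lambda>h. J t h - t *\<^sub>R H K (\<phi> t) (J t h))) (at w)"
        by (intro has_derivative_diff elim(1) has_derivative_scaleR_right)
      then show ?case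
        by (simp add: g_def batch_grad_def[abs_def] blinfun.diff_left[abs_def] blinfun.scaleR_left[abs_def])
    qed
    \<comment> \<open>The new position error is the old one minus \<open>t\<close> times the
      deviation of the gradient from its value at \<open>w\<close>; the Jacobian error below is
      treated in the same way.\<close>
    have "(\<lambda>t. norm ((\<phi> t - (w - t *\<^sub>R (\<Sum>k<K. batch_grad L B k w))) - t *\<^sub>R (g (\<phi> t) - g w)))
        \<in> O[at_right 0](\<lambda>t. t\<^sup>2)"
      using bounded_bilinear.norm_prod_bigo[OF bounded_bilinear_scaleR t g_near]
      by (intro norm_diff_bigo \<phi>) (simp only: power2_eq_square)
    then show "(\<lambda>t. norm (inner_loop L B t w (Suc K) -
        (w - t *\<^sub>R (\<Sum>k<Suc K. batch_grad L B k w)))) \<in> O[at_right 0](\<lambda>t. t\<^sup>2)"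
      by (simp add: g_def \<phi>_def batch_grad_def algebra_simps)
    have "(\<lambda>t. norm ((J t - (id_blinfun - t *\<^sub>R (\<Sum>k<K. H k w)))
        - t *\<^sub>R ((H K (\<phi> t) o\<^sub>L J t) - H K w))) \<in> O[at_right 0](\<lambda>t. t\<^sup>2)"
      using bounded_bilinear.norm_prod_bigo[OF bounded_bilinear_scaleR t HJ_near]
      by (intro norm_diff_bigo J) (simp only: power2_eq_square)
    then show "(\<lambda>t. norm (J t - t *\<^sub>R (H K (\<phi> t) o\<^sub>L J t) -
        (id_blinfun - t *\<^sub>R (\<Sum>k<Suc K. H k w)))) \<in> O[at_right 0](\<lambda>t. t\<^sup>2)"
      by (simp add: algebra_simps)
  qed
qed

text \<open>This is the product rule tested against a direction \<open>h\<close>; the pairing keeps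
  the Hessians acting on \<open>h\<close>, so no adjoints have to be introduced.\<close>

lemma grad_alignment_inner:
  fixes L :: "'a::euclidean_space \<Rightarrow> 'b \<Rightarrow> real" and H :: "nat \<Rightarrow> 'a \<Rightarrow>\<^sub>L 'a"
  assumes "\<And>k. k \<le> K \<Longrightarrow> (batch_grad L B k has_derivative blinfun_apply (H k)) (at w)"
  shows "inner (grad_alignment L B K w) h =
    inner (H K h) (\<Sum>k<K. batch_grad L B k w) + inner (batch_grad L B K w) ((\<Sum>k<K. H k) h)"
proof -
  have "inner (grad (\<lambda>\<phi>. inner (batch_grad L B K \<phi>) (batch_grad L B k \<phi>)) w) h =
      inner (H K h) (batch_grad L B k w) + inner (batch_grad L B K w) (H k h)" if "k < K" for k
    using has_derivative_imp_GDERIV_grad(2)[OF has_derivative_inner[OF assms assms], of K k h] that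
    by (simp add: inner_commute add.commute)
  then show ?thesis
    by (simp add: grad_alignment_def inner_sum_left inner_sum_right blinfun.sum_left sum.distrib)
qed

text \<open>The first conclusion certifies that \<open>g_pp\<close> is a true gradient for small
  rates, since \<open>grad\<close> alone would also return some unspecified value where none
  exists.\<close>

lemma meta_gradient_expansion:
  fixes L :: "'a::euclidean_space \<Rightarrow> 'b \<Rightarrow> real"
  assumes thrice: "\<And>k. k \<le> K \<Longrightarrow> thrice_differentiable_at (\<lambda>\<phi>. L \<phi> (B k)) w"
  shows "\<forall>\<^sub>F t in at_right 0. GDERIV (meta_loss L B K \<gamma> t) w :> g_pp L B K \<gamma> t w"
    and "(\<lambda>t. norm (g_pp L B K \<gamma> t w -
          ((1 - \<gamma>) *\<^sub>R batch_grad L B K w - t *\<^sub>R grad_alignment L B K w)))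
        \<in> O[at_right 0](\<lambda>t. t\<^sup>2)"
proof -
  \<comment> \<open>Bundling the four properties lets a single choice produce a family of Hessians
    indexed by \<open>k\<close>.\<close>
  define P where "P k H \<longleftrightarrow>
      (\<forall>\<^sub>F y in nhds w. GDERIV (\<lambda>\<phi>. L \<phi> (B k)) y :> batch_grad L B k y) \<and>
      (\<forall>\<^sub>F y in nhds w. (batch_grad L B k has_derivative blinfun_apply (H y)) (at y)) \<and>
      (\<lambda>y. norm (H y - H w)) \<in> O[nhds w](\<lambda>y. norm (y - w)) \<and>
      (\<forall>u v. inner (H w u) v = inner u (H w v))" for k and H :: "'a \<Rightarrow> 'a \<Rightarrow>\<^sub>L 'a"
  have "\<exists>H. P k H" if "k \<le> K" for k
  proof -
    obtain H :: "'a \<Rightarrow> 'a \<Rightarrow>\<^sub>L 'a" where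
      "\<forall>\<^sub>F y in nhds w. GDERIV (\<lambda>\<phi>. L \<phi> (B k)) y :> grad (\<lambda>\<phi>. L \<phi> (B k)) y"
      "\<forall>\<^sub>F y in nhds w. (grad (\<lambda>\<phi>. L \<phi> (B k)) has_derivative blinfun_apply (H y)) (at y)"
      "(\<lambda>y. norm (H y - H w)) \<in> O[nhds w](\<lambda>y. norm (y - w))"
      "\<forall>u v. inner (H w u) v = inner u (H w v)"
      by (rule thrice_differentiable_at_hessian[OF thrice[OF \<open>k \<le> K\<close>]])
    then show ?thesis by (intro exI[of _ H]) (simp add: P_def batch_grad_def[abs_def])
  qed
  then obtain H where "\<And>k. k \<le> K \<Longrightarrow> P k (H k)" by metis
  then have
    gderiv: "\<And>k. k \<le> K \<Longrightarrow> \<forall>\<^sub>F y in nhds w. GDERIV (\<lambda>\<phi>. L \<phi> (B k)) y :> batch_grad L B k y"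
    and g_der: "\<And>k. k \<le> K \<Longrightarrow>
      \<forall>\<^sub>F y in nhds w. (batch_grad L B k has_derivative blinfun_apply (H k y)) (at y)"
    and H_lip: "\<And>k. k \<le> K \<Longrightarrow> (\<lambda>y. norm (H k y - H k w)) \<in> O[nhds w](\<lambda>y. norm (y - w))"
    and H_sym: "\<And>k u v. k \<le> K \<Longrightarrow> inner (H k w u) v = inner u (H k w v)"
    by (simp_all add: P_def)
  define \<phi> where "\<phi> t = inner_loop L B t w K" for t
  define g where "g = batch_grad L B K"
  define s where "s = (\<Sum>k<K. batch_grad L B k w)"
  define S where "S = (\<Sum>k<K. H k w)"
  obtain J where
    der: "\<forall>\<^sub>F t in at_right 0. ((\<lambda>w. inner_loop L B t w K) has_derivative blinfun_apply (J t)) (at w)"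
    and \<phi>: "(\<lambda>t. norm (\<phi> t - (w - t *\<^sub>R s))) \<in> O[at_right 0](\<lambda>t. t\<^sup>2)"
    and J: "(\<lambda>t. norm (J t - (id_blinfun - t *\<^sub>R S))) \<in> O[at_right 0](\<lambda>t. t\<^sup>2)"
    using inner_loop_expansion[OF g_der[OF less_imp_le] H_lip[OF less_imp_le]]
    unfolding \<phi>_def s_def S_def by blast
  note \<phi>_near = first_order_imp_near[OF \<phi>]
  note \<phi>_lim = near_imp_tendsto[OF \<phi>_near]
  \<comment> \<open>This is the first-order expansion of the query gradient at the end of the inner
    loop: Taylor's formula at \<open>w\<close> with the displacement \<open>\<phi> t - w\<close>
    replaced by \<open>- t s\<close>. Both the Taylor remainder and the replacement cost
    \<open>O(t\<^sup>2)\<close>.\<close>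
  define p where "p t = g w - t *\<^sub>R H K w s" for t
  have g_exp: "(\<lambda>t. norm (g (\<phi> t) - p t)) \<in> O[at_right 0](\<lambda>t. t\<^sup>2)"
  proof -
    have "(\<lambda>y. norm (g y - g w - H K w (y - w))) \<in> O[nhds w](\<lambda>y. (norm (y - w))\<^sup>2)"
      unfolding g_def using g_der H_lip by (intro quadratic_remainder_bigo) auto
    from landau_o.big.compose[OF this \<phi>_lim]
    have "(\<lambda>t. norm (g (\<phi> t) - g w - H K w (\<phi> t - w))) \<in> O[at_right 0](\<lambda>t. (norm (\<phi> t - w))\<^sup>2)" .
    also have "(\<lambda>t. (norm (\<phi> t - w))\<^sup>2) \<in> O[at_right 0](\<lambda>t. t\<^sup>2)"
      using \<phi>_near by (rule landau_o.big_power)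
    finally have "(\<lambda>t. norm (g (\<phi> t) - g w - H K w (\<phi> t - w))) \<in> O[at_right 0](\<lambda>t. t\<^sup>2)" .
    moreover have "(\<lambda>t. norm (H K w (\<phi> t - (w - t *\<^sub>R s)))) \<in> O[at_right 0](\<lambda>t. 1 * t\<^sup>2)"
      by (intro bounded_bilinear.norm_prod_bigo[OF bounded_bilinear_blinfun_apply] \<phi>) simp
    ultimately have "(\<lambda>t. norm ((g (\<phi> t) - g w - H K w (\<phi> t - w)) + H K w (\<phi> t - (w - t *\<^sub>R s))))
        \<in> O[at_right 0](\<lambda>t. t\<^sup>2)"
      by (intro norm_add_bigo) simp_all
    then show ?thesis
      by (simp add: p_def blinfun.bilinear_simps algebra_simps)
  qed
  have der_meta: "\<forall>\<^sub>F t in at_right 0.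
      (meta_loss L B K \<gamma> t has_derivative (\<lambda>h. inner (J t h) (g (\<phi> t)) - \<gamma> * inner h (g w))) (at w)"
  proof -
    have "\<forall>\<^sub>F t in at_right 0. GDERIV (\<lambda>\<phi>. L \<phi> (B K)) (\<phi> t) :> g (\<phi> t)"
      using \<phi>_lim gderiv[OF order_refl] unfolding g_def
      by (rule filterlim_iff[THEN iffD1, rule_format])
    with der show ?thesis
    proof eventually_elim
      case (elim t)
      have 1: "((\<lambda>\<phi>. L \<phi> (B K)) has_derivative (\<lambda>h. inner h (g w))) (at w)"
        using eventually_nhds_x_imp_x[OF gderiv[OF order_refl]] by (simp add: gderiv_def g_def)
      have "((\<lambda>w. L (inner_loop L B t w K) (B K)) has_derivative (\<lambda>h. inner (J t h) (g (\<phi> t)))) (at w)"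
        using elim unfolding \<phi>_def gderiv_def by (rule has_derivative_compose)
      then show ?case
        unfolding meta_loss_def[abs_def] L_pp_def
        by (intro has_derivative_diff has_derivative_mult_right 1)
    qed
  qed
  show "\<forall>\<^sub>F t in at_right 0. GDERIV (meta_loss L B K \<gamma> t) w :> g_pp L B K \<gamma> t w"
    using der_meta by eventually_elim (simp add: g_pp_def has_derivative_imp_GDERIV_grad(1))
  define I where "I = grad_alignment L B K w"
  define e where "e t = g_pp L B K \<gamma> t w - ((1 - \<gamma>) *\<^sub>R g w - t *\<^sub>R I)" for t
  \<comment> \<open>\<open>E t\<close> is the functional represented by \<open>e t\<close>; this avoids the adjoint of \<open>J t\<close>.\<close>
  define E where "E t = (blinfun_inner_right (g (\<phi> t) - p t) o\<^sub>L J t)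
      + (blinfun_inner_right (p t) o\<^sub>L (J t - (id_blinfun - t *\<^sub>R S)))
      + t\<^sup>2 *\<^sub>R (blinfun_inner_right (H K w s) o\<^sub>L S)" for t
  \<comment> \<open>Symmetry of \<open>H K w\<close> is used here: the product rule yields the
    pairing of \<open>H K w h\<close> with \<open>s\<close>, while the chain rule produces that of
    \<open>H K w s\<close> with \<open>h\<close>.\<close>
  have I: "inner I h = inner (H K w s) h + inner (g w) (S h)" for h
    unfolding I_def g_def s_def S_def
    using grad_alignment_inner[of K L B "\<lambda>k. H k w" w h] eventually_nhds_x_imp_x[OF g_der]
      H_sym[OF order_refl] by (simp add: inner_commute)
  have e_eq: "\<forall>\<^sub>F t in at_right 0. norm (e t) \<le> norm (E t)"
    using der_meta
  proof eventually_elim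
    case (elim t)
    \<comment> \<open>In expanding \<open>E t h\<close>, pairing \<open>p t\<close> with
      \<open>t S h\<close> leaves a product of the two first-order terms \<open>- t H K w s\<close>
      and \<open>t S h\<close>; the last summand of \<open>E t\<close> cancels it.\<close>
    have "inner (e t) h = E t h" for h
      using has_derivative_imp_GDERIV_grad(2)[OF elim, of h] I[of h]
      by (simp add: e_def E_def p_def g_pp_def[symmetric] blinfun.bilinear_simps inner_simps
          inner_commute[of _ h] inner_commute[of "J t h"] algebra_simps power2_eq_square)
    \<comment> \<open>Testing the functional on \<open>e t\<close> itself bounds the square of
      \<open>norm (e t)\<close> by \<open>norm (E t) * norm (e t)\<close>.\<close>
    then have "norm (e t) * norm (e t) \<le> norm (E t) * norm (e t)"
      using norm_blinfun[of "E t" "e t"]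
      by (metis abs_of_nonneg dot_square_norm inner_ge_zero power2_eq_square real_norm_def)
    then show ?case by (cases "e t = 0") simp_all
  qed
  have "(\<lambda>t. norm (E t)) \<in> O[at_right 0](\<lambda>t. t\<^sup>2)"
    unfolding E_def
  proof (intro norm_add_bigo)
    have inner_right: "(\<lambda>t. norm (blinfun_inner_right (f t))) \<in> O[at_right 0](h)"
      if "(\<lambda>t. norm (f t)) \<in> O[at_right 0](h)" for f :: "real \<Rightarrow> 'a" and h :: "real \<Rightarrow> real"
    proof -
      have "norm (blinfun_inner_right x) \<le> norm x" for x :: 'a
        by (rule norm_blinfun_bound) (simp_all add: Cauchy_Schwarz_ineq2)
      then have "(\<lambda>t. norm (blinfun_inner_right (f t))) \<in> O[at_right 0](\<lambda>t. norm (f t))"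
        by (intro bigoI[of _ 1]) simp
      then show ?thesis using that by (rule landau_o.big_trans)
    qed
    note comp = bounded_bilinear.norm_prod_bigo[OF bounded_bilinear_blinfun_compose]
    have "(\<lambda>t. norm (J t)) \<in> O[at_right 0](\<lambda>_. 1)"
      using first_order_imp_near[OF J] ident_bigo_1_at_right_0 by (rule norm_bigo_1_if_near)
    from comp[OF inner_right[OF g_exp] this]
    show "(\<lambda>t. norm (blinfun_inner_right (g (\<phi> t) - p t) o\<^sub>L J t)) \<in> O[at_right 0](\<lambda>t. t\<^sup>2)" by simp
    have "(\<lambda>t. norm (p t - (g w - t *\<^sub>R H K w s))) \<in> O[at_right 0](\<lambda>t. t\<^sup>2)" by (simp add: p_def)
    from norm_bigo_1_if_near[OF first_order_imp_near[OF this] ident_bigo_1_at_right_0]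
    have "(\<lambda>t. norm (p t)) \<in> O[at_right 0](\<lambda>_. 1)" .
    from comp[OF inner_right[OF this] J]
    show "(\<lambda>t. norm (blinfun_inner_right (p t) o\<^sub>L (J t - (id_blinfun - t *\<^sub>R S))))
        \<in> O[at_right 0](\<lambda>t. t\<^sup>2)" by simp
    show "(\<lambda>t. norm (t\<^sup>2 *\<^sub>R (blinfun_inner_right (H K w s) o\<^sub>L S))) \<in> O[at_right 0](\<lambda>t. t\<^sup>2)"
      by (intro bigoI[of _ "norm (blinfun_inner_right (H K w s) o\<^sub>L S)"]) (simp add: mult.commute)
  qed
  moreover have "(\<lambda>t. norm (e t)) \<in> O[at_right 0](\<lambda>t. norm (E t))"
    using e_eq by (intro bigoI[of _ 1]) simp
  ultimately have "(\<lambda>t. norm (e t)) \<in> O[at_right 0](\<lambda>t. t\<^sup>2)"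
    by (rule landau_o.big_trans[rotated])
  then show "(\<lambda>t. norm (g_pp L B K \<gamma> t w -
          ((1 - \<gamma>) *\<^sub>R batch_grad L B K w - t *\<^sub>R grad_alignment L B K w)))
        \<in> O[at_right 0](\<lambda>t. t\<^sup>2)"
    by (simp add: e_def g_def I_def)
qed

section \<open>Change of the query loss under the outer update\<close>

lemma thrice_differentiable_at_quadratic_remainder:
  fixes f :: "'a::euclidean_space \<Rightarrow> real"
  assumes "thrice_differentiable_at f x"
  shows "(\<lambda>y. f y - f x - inner (grad f x) (y - x)) \<in> O[nhds x](\<lambda>y. (norm (y - x))\<^sup>2)"
proof -
  obtain H :: "'a \<Rightarrow> 'a \<Rightarrow>\<^sub>L 'a" where
    gd: "\<forall>\<^sub>F y in nhds x. GDERIV f y :> grad f y"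
    and H: "\<forall>\<^sub>F y in nhds x. (grad f has_derivative blinfun_apply (H y)) (at y)"
    by (rule thrice_differentiable_at_hessian[OF assms])
  have der: "\<forall>\<^sub>F y in nhds x. (f has_derivative blinfun_apply (blinfun_inner_right (grad f y))) (at y)"
    using gd by eventually_elim (simp add: gderiv_def inner_commute[of _ "grad f _"])
  have "(\<lambda>y. blinfun_inner_right (grad f y)) differentiable at x"
    using bounded_linear.has_derivative[OF bounded_linear_blinfun_inner_right
        eventually_nhds_x_imp_x[OF H]] unfolding differentiable_def by blast
  from quadratic_remainder_bigo[OF der differentiable_at_bigo[OF this]]
  show ?thesis by simp
qed

text \<open>Taylor's formula for the query loss is applied to the step
  \<open>- lout * G lin\<close>. Replacing \<open>G lin\<close> by \<open>(1 - \<gamma>) g\<close>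
  in the linear term gives the leading term and leaves \<open>R1\<close>; the Taylor remainder is
  \<open>R2\<close>. Here only \<open>G lin = (1 - \<gamma>) g + O(lin)\<close> is required.\<close>

lemma delta_L_expansion:
  fixes L :: "'a::euclidean_space \<Rightarrow> 'b \<Rightarrow> real"
  assumes thrice: "\<And>k. k \<le> K \<Longrightarrow> thrice_differentiable_at (\<lambda>\<phi>. L \<phi> (B k)) w"
  shows "\<exists>R1 R2 :: real \<times> real \<Rightarrow> real.
       R1 \<in> O[at_right 0 \<times>\<^sub>F at_right 0](\<lambda>(lin, lout). lin * lout) \<and>
       R2 \<in> O[at_right 0 \<times>\<^sub>F at_right 0](\<lambda>(lin, lout). lout ^ 2) \<and>
       (\<forall>lin>0. \<forall>lout>0. delta_L L B K \<gamma> lin lout w =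
          - lout * (1 - \<gamma>) * (norm (batch_grad L B K w))\<^sup>2 + R1 (lin, lout) + R2 (lin, lout))"
proof -
  let ?F = "at_right (0::real) \<times>\<^sub>F at_right (0::real)"
  define g where "g = batch_grad L B K w"
  define G where "G t = g_pp L B K \<gamma> t w" for t
  define r where "r y = L y (B K) - L w (B K) - inner g (y - w)" for y
  define R1 where "R1 = (\<lambda>x. - (snd x * inner g (G (fst x) - (1 - \<gamma>) *\<^sub>R g)))"
  define R2 where "R2 = (\<lambda>x. r (w - snd x *\<^sub>R G (fst x)))"
  have G_near: "(\<lambda>t. norm (G t - (1 - \<gamma>) *\<^sub>R g)) \<in> O[at_right 0](\<lambda>t. t)"
    unfolding G_def g_def
    by (rule first_order_imp_near, rule meta_gradient_expansion(2), fact thrice)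
  note G_bound = norm_bigo_1_if_near[OF G_near ident_bigo_1_at_right_0]
  have "R1 \<in> O[?F](\<lambda>x. snd x * fst x)"
  proof -
    have "(\<lambda>t. norm (inner g (G t - (1 - \<gamma>) *\<^sub>R g))) \<in> O[at_right 0](\<lambda>t. 1 * t)"
      by (intro bounded_bilinear.norm_prod_bigo[OF bounded_bilinear_inner] G_near) simp
    then have "(\<lambda>t. inner g (G t - (1 - \<gamma>) *\<^sub>R g)) \<in> O[at_right 0](\<lambda>t. t)" by simp
    from landau_o.big.compose[OF this filterlim_fst] show ?thesis
      unfolding R1_def by (subst landau_o.big.uminus_in_iff) (rule landau_o.big.mult[OF landau_o.big_refl])
  qed
  moreover have "R2 \<in> O[?F](\<lambda>x. (snd x)\<^sup>2)"
  proof -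
    have step: "(\<lambda>x. norm (snd x *\<^sub>R G (fst x))) \<in> O[?F](\<lambda>x. snd x)"
    proof -
      have "(\<lambda>x. norm (snd x)) \<in> O[?F](snd)" by simp
      moreover have "(\<lambda>x. norm (G (fst x))) \<in> O[?F](\<lambda>_. 1)"
        using landau_o.big.compose[OF G_bound filterlim_fst] .
      ultimately have "(\<lambda>x. norm (snd x *\<^sub>R G (fst x))) \<in> O[?F](\<lambda>x. snd x * 1)"
        by (rule bounded_bilinear.norm_prod_bigo[OF bounded_bilinear_scaleR])
      then show ?thesis by simp
    qed
    have "(snd \<longlongrightarrow> 0) ?F"
      using filterlim_snd[of "at_right (0::real)" "at_right (0::real)"]
      by (rule filterlim_mono) (simp_all add: at_within_le_nhds)
    \<comment> \<open>The Taylor bound holds only near \<open>w\<close>, so the updated point must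
      tend to \<open>w\<close> along the product filter. This follows because \<open>G\<close> stays
      bounded for small \<open>lin\<close> while \<open>lout\<close> tends to 0.\<close>
    have lim: "((\<lambda>x. w - snd x *\<^sub>R G (fst x)) \<longlongrightarrow> w) ?F"
    proof -
      obtain C where "\<forall>\<^sub>F x in ?F. norm (norm (snd x *\<^sub>R G (fst x))) \<le> C * norm (snd x)"
        using step by (auto elim!: landau_o.bigE)
      moreover have "((\<lambda>x. C * norm (snd x)) \<longlongrightarrow> 0) ?F"
        by (rule tendsto_mult_right_zero[OF tendsto_norm_zero[OF \<open>(snd \<longlongrightarrow> 0) ?F\<close>]])
      ultimately have "((\<lambda>x. snd x *\<^sub>R G (fst x)) \<longlongrightarrow> 0) ?F"
        by (auto intro: Lim_null_comparison)
      from tendsto_diff[OF tendsto_const this] show ?thesis by simp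
    qed
    have "r \<in> O[nhds w](\<lambda>y. (norm (y - w))\<^sup>2)"
      unfolding r_def g_def batch_grad_def
      using thrice[OF order_refl] by (rule thrice_differentiable_at_quadratic_remainder)
    from landau_o.big.compose[OF this lim]
    have "R2 \<in> O[?F](\<lambda>x. (norm (snd x *\<^sub>R G (fst x)))\<^sup>2)"
      by (simp add: R2_def)
    also have "(\<lambda>x. (norm (snd x *\<^sub>R G (fst x)))\<^sup>2) \<in> O[?F](\<lambda>x. (snd x)\<^sup>2)"
      using step by (rule landau_o.big_power)
    finally show ?thesis .
  qed
  \<comment> \<open>The identity is exact for all rates, including those for which
    \<open>g_pp\<close> might be an unspecified value: \<open>R1\<close> and \<open>R2\<close> are
    defined from \<open>G\<close> itself, and only their asymptotic bounds depend on small
    rates.\<close>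
  moreover have "delta_L L B K \<gamma> lin lout w
      = - lout * (1 - \<gamma>) * (norm g)\<^sup>2 + R1 (lin, lout) + R2 (lin, lout)" for lin lout
    by (simp add: delta_L_def outer_update_def R1_def R2_def r_def G_def inner_diff_right
        dot_square_norm algebra_simps)
  ultimately show ?thesis
    by (intro exI[of _ R1] exI[of _ R2]) (auto simp: case_prod_unfold g_def mult.commute)
qed

theorem proposition3:
  fixes L :: "real ^ 'd \<Rightarrow> 'b \<Rightarrow> real"
    and B :: "nat \<Rightarrow> 'b"
    and K :: nat
    and \<gamma> :: real
    and w :: "real ^ 'd"
  assumes "K \<ge> 1"
    and "0 \<le> \<gamma>" and "\<gamma> \<le> 1"
    and "\<And>k. k \<le> K \<Longrightarrow> thrice_differentiable_at (\<lambda>\<phi>. L \<phi> (B k)) w"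
  shows "(\<forall>\<^sub>F lin in at_right 0. GDERIV (meta_loss L B K \<gamma> lin) w :> g_pp L B K \<gamma> lin w) \<and>
    (\<lambda>lin. norm (g_pp L B K \<gamma> lin w -
        ((1 - \<gamma>) *\<^sub>R batch_grad L B K w - lin *\<^sub>R grad_alignment L B K w)))
      \<in> O[at_right 0](\<lambda>lin. lin ^ 2) \<and>
    (\<exists>R1 R2 :: real \<times> real \<Rightarrow> real.
       R1 \<in> O[at_right 0 \<times>\<^sub>F at_right 0](\<lambda>(lin, lout). lin * lout) \<and>
       R2 \<in> O[at_right 0 \<times>\<^sub>F at_right 0](\<lambda>(lin, lout). lout ^ 2) \<and>
       (\<forall>lin>0. \<forall>lout>0. delta_L L B K \<gamma> lin lout w =
          - lout * (1 - \<gamma>) * (norm (batch_grad L B K w))\<^sup>2 + R1 (lin, lout) + R2 (lin, lout))) \<and>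
    (\<forall>lout>0. - lout * (1 - \<gamma>) * (norm (batch_grad L B K w))\<^sup>2 \<le> 0)"
proof (intro conjI)
  show "\<forall>lout>0. - lout * (1 - \<gamma>) * (norm (batch_grad L B K w))\<^sup>2 \<le> 0"
    using \<open>\<gamma> \<le> 1\<close> by simp
qed (use meta_gradient_expansion[of K L B w \<gamma>] delta_L_expansion[of K L B w \<gamma>] assms(4) in blast)+

end
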